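(* Let $S$ be a quandle and $T$ a medial quandle. Then $S/m_S$ is medial and $\mathrm{Hom}(S,T)\cong\mathrm{Hom}(S/m_S,T)$ as quandles.
   Context: A quandle is a set $Q$ with a binary operation $\triangleright$ such that $x\triangleright x=x$; for all $y,z$ there is a unique $x$ with $y\triangleright x=z$ (left divisibility); and $x\triangleright(y\triangleright z)=(x\triangleright y)\triangleright(x\triangleright z)$. It is medial if $(x\triangleright y)\triangleright(z\triangleright w)=(x\triangleright z)\triangleright(y\triangleright w)$ for all $x,y,z,w$. A congruence on $Q$ is an equivalence relation compatible with $\triangleright$ and with left division, so that the quotient is again a quandle. $m_Q$ denotes the congruence on $Q$ generated by all pairs $((a\triangleright b)\triangleright(c\triangleright d),\ (a\triangleright c)\triangleright(b\triangleright d))$ with $a,b,c,d\in Q$. For $T$ medial and any quandle $S$, the set $\mathrm{Hom}(S,T)$ of quandle homomorphisms is a (medial) quandle under the pointwise operation $(h\triangleright k)(a)=h(a)\triangleright k(a)$ (known). *)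

theory Defs
  imports "HOL-Algebra.Congruence" "HOL-Library.FuncSet"
begin

record 'a magma = "'a partial_object" +
  qop :: "'a \<Rightarrow> 'a \<Rightarrow> 'a" (infixl \<open>\<triangleright>\<index>\<close> 70)

locale quandle =
  fixes Q :: "('a, 'm) magma_scheme" (structure)
  assumes closed: "\<lbrakk>x \<in> carrier Q; y \<in> carrier Q\<rbrakk> \<Longrightarrow> x \<triangleright> y \<in> carrier Q"
    and idem: "x \<in> carrier Q \<Longrightarrow> x \<triangleright> x = x"
    and ex1_ldiv: "\<lbrakk>y \<in> carrier Q; z \<in> carrier Q\<rbrakk> \<Longrightarrow> \<exists>!x. x \<in> carrier Q \<and> y \<triangleright> x = z"
    and ldistrib: "\<lbrakk>x \<in> carrier Q; y \<in> carrier Q; z \<in> carrier Q\<rbrakk>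
      \<Longrightarrow> x \<triangleright> (y \<triangleright> z) = (x \<triangleright> y) \<triangleright> (x \<triangleright> z)"

locale medial_quandle = quandle +
  assumes medial: "\<lbrakk>x \<in> carrier Q; y \<in> carrier Q; z \<in> carrier Q; w \<in> carrier Q\<rbrakk>
      \<Longrightarrow> (x \<triangleright> y) \<triangleright> (z \<triangleright> w) = (x \<triangleright> z) \<triangleright> (y \<triangleright> w)"

definition ldiv :: "('a, 'm) magma_scheme \<Rightarrow> 'a \<Rightarrow> 'a \<Rightarrow> 'a" where
  "ldiv Q y z = (THE x. x \<in> carrier Q \<and> y \<triangleright>\<^bsub>Q\<^esub> x = z)"

definition quandle_cong :: "('a, 'm) magma_scheme \<Rightarrow> ('a \<times> 'a) set \<Rightarrow> bool" where
  "quandle_cong Q r \<longleftrightarrow> equiv (carrier Q) r \<and>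
     (\<forall>a a' b b'. (a, a') \<in> r \<and> (b, b') \<in> r \<longrightarrow>
        (a \<triangleright>\<^bsub>Q\<^esub> b, a' \<triangleright>\<^bsub>Q\<^esub> b') \<in> r \<and> (ldiv Q a b, ldiv Q a' b') \<in> r)"

definition generated_cong :: "('a, 'm) magma_scheme \<Rightarrow> ('a \<times> 'a) set \<Rightarrow> ('a \<times> 'a) set" where
  "generated_cong Q X = \<Inter> {r. quandle_cong Q r \<and> X \<subseteq> r}"

definition medial_cong :: "('a, 'm) magma_scheme \<Rightarrow> ('a \<times> 'a) set" where
  "medial_cong Q = generated_cong Q
     {((a \<triangleright>\<^bsub>Q\<^esub> b) \<triangleright>\<^bsub>Q\<^esub> (c \<triangleright>\<^bsub>Q\<^esub> d), (a \<triangleright>\<^bsub>Q\<^esub> c) \<triangleright>\<^bsub>Q\<^esub> (b \<triangleright>\<^bsub>Q\<^esub> d)) | a b c d.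
        a \<in> carrier Q \<and> b \<in> carrier Q \<and> c \<in> carrier Q \<and> d \<in> carrier Q}"

text \<open>When \<open>r\<close> is a congruence, the union below is over equal classes, so the product of the
  classes of \<open>x\<close> and \<open>y\<close> is the class of the product of \<open>x\<close> and \<open>y\<close>
  (lemma \<open>quotient_qop_class\<close>).\<close>

definition quotient_quandle :: "('a, 'm) magma_scheme \<Rightarrow> ('a \<times> 'a) set \<Rightarrow> 'a set magma" where
  "quotient_quandle Q r =
     \<lparr>carrier = carrier Q // r,
      qop = (\<lambda>X Y. \<Union>x\<in>X. \<Union>y\<in>Y. r `` {x \<triangleright>\<^bsub>Q\<^esub> y})\<rparr>"

text \<open>Homomorphisms are extensional functions (\<open>undefined\<close> off the carrier), so that
  equality in the set of homomorphisms is equality of maps between the carriers.\<close>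

definition quandle_hom ::
  "('a, 'm) magma_scheme \<Rightarrow> ('b, 'n) magma_scheme \<Rightarrow> ('a \<Rightarrow> 'b) set" where
  "quandle_hom S T = {h \<in> carrier S \<rightarrow>\<^sub>E carrier T.
     \<forall>a\<in>carrier S. \<forall>b\<in>carrier S. h (a \<triangleright>\<^bsub>S\<^esub> b) = h a \<triangleright>\<^bsub>T\<^esub> h b}"

definition Hom_quandle ::
  "('a, 'm) magma_scheme \<Rightarrow> ('b, 'n) magma_scheme \<Rightarrow> ('a \<Rightarrow> 'b) magma" where
  "Hom_quandle S T =
     \<lparr>carrier = quandle_hom S T,
      qop = (\<lambda>h k. \<lambda>a\<in>carrier S. h a \<triangleright>\<^bsub>T\<^esub> k a)\<rparr>"

definition quandle_isomorphic ::
  "('a, 'm) magma_scheme \<Rightarrow> ('b, 'n) magma_scheme \<Rightarrow> bool" (infix \<open>\<cong>\<^sub>q\<close> 50) where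
  "Q \<cong>\<^sub>q R \<longleftrightarrow> (\<exists>f \<in> quandle_hom Q R. bij_betw f (carrier Q) (carrier R))"

lemma (in quandle) ldiv_closed:
  assumes "y \<in> carrier Q" "z \<in> carrier Q"
  shows "ldiv Q y z \<in> carrier Q" "y \<triangleright> ldiv Q y z = z"
  using theI'[OF ex1_ldiv[OF assms]] by (auto simp: ldiv_def)

lemma (in quandle) quandle_cong_full: "quandle_cong Q (carrier Q \<times> carrier Q)"
proof -
  have "equiv (carrier Q) (carrier Q \<times> carrier Q)"
    by (rule equivI) (auto simp: refl_on_def sym_def trans_def)
  then show ?thesis
    by (simp add: quandle_cong_def closed ldiv_closed(1))
qed

lemma (in quandle) quandle_cong_generated:
  assumes "X \<subseteq> carrier Q \<times> carrier Q"
  shows "quandle_cong Q (generated_cong Q X)"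
proof -
  let ?C = "{r. quandle_cong Q r \<and> X \<subseteq> r}"
  have full: "carrier Q \<times> carrier Q \<in> ?C"
    using quandle_cong_full assms by simp
  have e: "equiv (carrier Q) r" if "r \<in> ?C" for r
    using that by (simp add: quandle_cong_def)
  have "equiv (carrier Q) (\<Inter>?C)"
  proof (rule equivI)
    show "\<Inter>?C \<subseteq> carrier Q \<times> carrier Q"
      using full by (rule Inter_lower)
    show "refl_on (carrier Q) (\<Inter>?C)"
      using e unfolding equiv_def refl_on_def by blast
    show "sym (\<Inter>?C)"
      using e unfolding equiv_def sym_def by blast
    show "trans (\<Inter>?C)"
      using e unfolding equiv_def trans_def by blast
  qed
  then show ?thesis
    unfolding generated_cong_def quandle_cong_def by blast
qed

lemma (in quandle) quandle_cong_medial_cong: "quandle_cong Q (medial_cong Q)"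
  unfolding medial_cong_def by (rule quandle_cong_generated) (auto intro: closed)

lemma quotient_qop_class:
  assumes "quandle_cong Q r" "x \<in> carrier Q" "y \<in> carrier Q"
  shows "r `` {x} \<triangleright>\<^bsub>quotient_quandle Q r\<^esub> r `` {y} = r `` {x \<triangleright>\<^bsub>Q\<^esub> y}"
proof -
  have e: "equiv (carrier Q) r" and c: "\<And>a b. (x, a) \<in> r \<Longrightarrow> (y, b) \<in> r \<Longrightarrow> (x \<triangleright>\<^bsub>Q\<^esub> y, a \<triangleright>\<^bsub>Q\<^esub> b) \<in> r"
    using assms(1) by (auto simp: quandle_cong_def)
  have eq: "r `` {a \<triangleright>\<^bsub>Q\<^esub> b} = r `` {x \<triangleright>\<^bsub>Q\<^esub> y}" if "a \<in> r `` {x}" "b \<in> r `` {y}" for a b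
    using equiv_class_eq[OF e c] that by blast
  have "x \<in> r `` {x}" "y \<in> r `` {y}"
    using equiv_class_self[OF e] assms(2,3) by blast+
  then have "(\<Union>a\<in>r `` {x}. \<Union>b\<in>r `` {y}. r `` {x \<triangleright>\<^bsub>Q\<^esub> y}) = r `` {x \<triangleright>\<^bsub>Q\<^esub> y}"
    by blast
  moreover have "(\<Union>a\<in>r `` {x}. \<Union>b\<in>r `` {y}. r `` {a \<triangleright>\<^bsub>Q\<^esub> b}) =
      (\<Union>a\<in>r `` {x}. \<Union>b\<in>r `` {y}. r `` {x \<triangleright>\<^bsub>Q\<^esub> y})"
    by (intro SUP_cong refl eq)
  ultimately show ?thesis
    by (simp only: quotient_quandle_def magma.simps partial_object.simps)
qed

lemma (in quandle) ldiv_unique: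
  assumes "y \<in> carrier Q" "x \<in> carrier Q" "y \<triangleright> x = z"
  shows "ldiv Q y z = x"
  unfolding ldiv_def
  by (rule the1_equality[OF ex1_ldiv]) (use assms closed in auto)

lemma (in medial_quandle) ldiv_medial:
  assumes "a \<in> carrier Q" "b \<in> carrier Q" "c \<in> carrier Q" "d \<in> carrier Q"
  shows "ldiv Q (a \<triangleright> b) (c \<triangleright> d) = ldiv Q a c \<triangleright> ldiv Q b d"
proof (rule ldiv_unique)
  show "a \<triangleright> b \<triangleright> (ldiv Q a c \<triangleright> ldiv Q b d) = c \<triangleright> d"
    using medial[of a b "ldiv Q a c" "ldiv Q b d"] assms by (simp add: ldiv_closed)
qed (use assms closed ldiv_closed in auto)

lemma medial_quandle_Hom:
  assumes "quandle S" and "medial_quandle T"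
  shows "medial_quandle (Hom_quandle S T)"
proof -
  interpret S: quandle S by (rule assms(1))
  interpret T: medial_quandle T by (rule assms(2))
  let ?H = "Hom_quandle S T"
  have car [simp]: "carrier ?H = quandle_hom S T" by (simp add: Hom_quandle_def)
  have qop_eq [simp]: "h \<triangleright>\<^bsub>?H\<^esub> k = (\<lambda>a\<in>carrier S. h a \<triangleright>\<^bsub>T\<^esub> k a)" for h k
    by (simp add: Hom_quandle_def)
  have val: "h a \<in> carrier T" if "h \<in> quandle_hom S T" "a \<in> carrier S" for h a
    using that by (auto simp: quandle_hom_def)
  have hom: "h (a \<triangleright>\<^bsub>S\<^esub> b) = h a \<triangleright>\<^bsub>T\<^esub> h b"
    if "h \<in> quandle_hom S T" "a \<in> carrier S" "b \<in> carrier S" for h a b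
    using that by (auto simp: quandle_hom_def)
  have ext: "h = k" if "h \<in> quandle_hom S T" "k \<in> quandle_hom S T"
    "\<And>a. a \<in> carrier S \<Longrightarrow> h a = k a" for h k
    using that by (auto simp: quandle_hom_def intro: PiE_ext)
  have memI: "(\<lambda>a\<in>carrier S. f a) \<in> quandle_hom S T"
    if "\<And>a. a \<in> carrier S \<Longrightarrow> f a \<in> carrier T"
      "\<And>a b. a \<in> carrier S \<Longrightarrow> b \<in> carrier S \<Longrightarrow> f (a \<triangleright>\<^bsub>S\<^esub> b) = f a \<triangleright>\<^bsub>T\<^esub> f b" for f
    using that by (auto simp: quandle_hom_def S.closed)
  have cl: "(\<lambda>a\<in>carrier S. h a \<triangleright>\<^bsub>T\<^esub> k a) \<in> quandle_hom S T"
    if "h \<in> quandle_hom S T" "k \<in> quandle_hom S T" for h k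
    using that by (intro memI) (simp_all add: val hom T.closed T.medial)
  show ?thesis
  proof unfold_locales
    fix h k assume "h \<in> carrier ?H" "k \<in> carrier ?H"
    then show "h \<triangleright>\<^bsub>?H\<^esub> k \<in> carrier ?H" by (simp add: cl)
  next
    fix h assume "h \<in> carrier ?H"
    then show "h \<triangleright>\<^bsub>?H\<^esub> h = h" by (intro ext) (simp_all add: cl val T.idem)
  next
    fix h g assume hg: "h \<in> carrier ?H" "g \<in> carrier ?H"
    let ?k = "\<lambda>a\<in>carrier S. ldiv T (h a) (g a)"
    have k: "?k \<in> quandle_hom S T"
      using hg by (intro memI) (simp_all add: val hom T.ldiv_closed T.ldiv_medial)
    show "\<exists>!x. x \<in> carrier ?H \<and> h \<triangleright>\<^bsub>?H\<^esub> x = g"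
    proof (rule ex1I[of _ ?k])
      have "h \<triangleright>\<^bsub>?H\<^esub> ?k = g"
        using hg cl[OF _ k] by (intro ext) (auto simp: val T.ldiv_closed)
      with k show "?k \<in> carrier ?H \<and> h \<triangleright>\<^bsub>?H\<^esub> ?k = g" by simp
    next
      fix x assume x: "x \<in> carrier ?H \<and> h \<triangleright>\<^bsub>?H\<^esub> x = g"
      show "x = ?k"
      proof (rule ext)
        fix a assume a: "a \<in> carrier S"
        have "h a \<triangleright>\<^bsub>T\<^esub> x a = g a" using x a by auto
        then have "ldiv T (h a) (g a) = x a"
          using hg x a by (intro T.ldiv_unique) (auto simp: val)
        then show "x a = ?k a" using a by simp
      qed (use x k in auto)
    qed
  next
    fix x y z assume "x \<in> carrier ?H" "y \<in> carrier ?H" "z \<in> carrier ?H"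
    then show "x \<triangleright>\<^bsub>?H\<^esub> (y \<triangleright>\<^bsub>?H\<^esub> z) = (x \<triangleright>\<^bsub>?H\<^esub> y) \<triangleright>\<^bsub>?H\<^esub> (x \<triangleright>\<^bsub>?H\<^esub> z)"
      by (auto simp: val fun_eq_iff restrict_def intro: T.ldistrib)
  next
    fix x y z w
    assume "x \<in> carrier ?H" "y \<in> carrier ?H" "z \<in> carrier ?H" "w \<in> carrier ?H"
    then show "(x \<triangleright>\<^bsub>?H\<^esub> y) \<triangleright>\<^bsub>?H\<^esub> (z \<triangleright>\<^bsub>?H\<^esub> w) = (x \<triangleright>\<^bsub>?H\<^esub> z) \<triangleright>\<^bsub>?H\<^esub> (y \<triangleright>\<^bsub>?H\<^esub> w)"
      by (auto simp: val fun_eq_iff restrict_def intro: T.medial)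
  qed
qed

end

theory Submission
  imports Defs
begin

text \<open>The kernel of a homomorphism \<open>h\<close> from \<open>S\<close> to a medial quandle is a congruence containing the
  pairs that generate \<open>m\<^sub>S\<close>, hence it contains \<open>m\<^sub>S\<close> and \<open>h\<close> factors uniquely through \<open>S/m\<^sub>S\<close>.
  As \<open>S/m\<^sub>S\<close> carries the operation of representatives, factoring commutes with the pointwise
  operation, and composing with the projection inverts it.\<close>

lemma carrier_quotient_quandle [simp]: "carrier (quotient_quandle Q r) = carrier Q // r"
  by (simp add: quotient_quandle_def)

lemma carrier_Hom_quandle [simp]: "carrier (Hom_quandle S T) = quandle_hom S T"
  by (simp add: Hom_quandle_def)

lemma qop_Hom_quandle: "h \<triangleright>\<^bsub>Hom_quandle S T\<^esub> k = (\<lambda>a\<in>carrier S. h a \<triangleright>\<^bsub>T\<^esub> k a)"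
  by (simp add: Hom_quandle_def)

lemma quandle_hom_closed: "\<lbrakk>h \<in> quandle_hom S T; a \<in> carrier S\<rbrakk> \<Longrightarrow> h a \<in> carrier T"
  by (auto simp: quandle_hom_def)

lemma quandle_hom_qop:
  "\<lbrakk>h \<in> quandle_hom S T; a \<in> carrier S; b \<in> carrier S\<rbrakk> \<Longrightarrow> h (a \<triangleright>\<^bsub>S\<^esub> b) = h a \<triangleright>\<^bsub>T\<^esub> h b"
  by (auto simp: quandle_hom_def)

lemma quandle_hom_ext:
  assumes "h \<in> quandle_hom S T" "k \<in> quandle_hom S T" "\<And>a. a \<in> carrier S \<Longrightarrow> h a = k a"
  shows "h = k"
  using assms by (auto simp: quandle_hom_def intro: PiE_ext)

text \<open>Homomorphisms are only required to respect \<triangleright>. Applying \<open>h\<close>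
  to the equation that defines \<open>ldiv S a b\<close> shows that its image solves
  \<open>h a\<close> \<triangleright> x = \<open>h b\<close>, and \<open>T\<close> has only one
  solution. A congruence must respect left division, so kernels need this.\<close>

lemma quandle_hom_ldiv:
  assumes "quandle S" "quandle T" "h \<in> quandle_hom S T" "a \<in> carrier S" "b \<in> carrier S"
  shows "h (ldiv S a b) = ldiv T (h a) (h b)"
proof -
  interpret S: quandle S by fact
  interpret T: quandle T by fact
  have "h a \<triangleright>\<^bsub>T\<^esub> h (ldiv S a b) = h b"
    using quandle_hom_qop[OF assms(3,4) S.ldiv_closed(1)[OF assms(4,5)]] assms(4,5)
    by (simp add: S.ldiv_closed)
  then show ?thesis
    using assms(3-5) T.ldiv_unique[of "h a" "h (ldiv S a b)" "h b"]
    by (simp add: quandle_hom_closed S.ldiv_closed)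
qed

lemma quandle_cong_kernel:
  assumes "quandle S" "quandle T" "h \<in> quandle_hom S T"
  shows "quandle_cong S {(a, b). a \<in> carrier S \<and> b \<in> carrier S \<and> h a = h b}"
    (is "quandle_cong S ?K")
proof -
  interpret S: quandle S by fact
  have "equiv (carrier S) ?K"
    by (rule equivI) (auto simp: refl_on_def sym_def trans_def)
  then show ?thesis
    using assms by (auto simp: quandle_cong_def S.closed S.ldiv_closed quandle_hom_qop quandle_hom_ldiv)
qed

text \<open>As an intersection, \<open>medial_cong S\<close> lies inside every congruence that
  contains the generating pairs. The kernel of \<open>h\<close> is one: \<open>h\<close> sends the
  two entries of a pair to the two sides of the medial law in \<open>T\<close>.\<close>

lemma medial_cong_subset_kernel:
  assumes "quandle S" "medial_quandle T" "h \<in> quandle_hom S T" "(a, b) \<in> medial_cong S"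
  shows "h a = h b"
proof -
  interpret S: quandle S by fact
  interpret T: medial_quandle T by fact
  have "medial_cong S \<subseteq> {(a, b). a \<in> carrier S \<and> b \<in> carrier S \<and> h a = h b}"
    unfolding medial_cong_def generated_cong_def
  proof (rule Inter_lower, rule CollectI, rule conjI)
    show "quandle_cong S {(a, b). a \<in> carrier S \<and> b \<in> carrier S \<and> h a = h b}"
      using quandle_cong_kernel[OF assms(1) T.quandle_axioms assms(3)] .
  qed (use assms(3) in \<open>auto simp: S.closed quandle_hom_qop[OF assms(3)]
      quandle_hom_closed[OF assms(3)] intro!: T.medial\<close>)
  with assms(4) show ?thesis by auto
qed

lemma (in quandle) medial_congI:
  assumes "a \<in> carrier Q" "b \<in> carrier Q" "c \<in> carrier Q" "d \<in> carrier Q"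
  shows "((a \<triangleright> b) \<triangleright> (c \<triangleright> d), (a \<triangleright> c) \<triangleright> (b \<triangleright> d)) \<in> medial_cong Q"
  using assms unfolding medial_cong_def generated_cong_def by blast

text \<open>Everything except unique left division passes to classes through representatives.
  Existence of a quotient comes from \<open>ldiv\<close> on representatives, uniqueness from
  compatibility of \<open>r\<close> with \<open>ldiv\<close>.\<close>

lemma (in quandle) quandle_quotient:
  assumes "quandle_cong Q r"
  shows "quandle (quotient_quandle Q r)"
proof -
  let ?R = "quotient_quandle Q r"
  have e: "equiv (carrier Q) r"
    and ld: "\<And>a a' b b'. (a, a') \<in> r \<Longrightarrow> (b, b') \<in> r \<Longrightarrow> (ldiv Q a b, ldiv Q a' b') \<in> r"
    using assms by (auto simp: quandle_cong_def)
  note cls = quotient_qop_class[OF assms]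
  show ?thesis
  proof
    fix y z assume "y \<in> carrier ?R" "z \<in> carrier ?R"
    then obtain a b where a: "a \<in> carrier Q" "y = r `` {a}" and b: "b \<in> carrier Q" "z = r `` {b}"
      by (auto elim!: quotientE)
    show "\<exists>!x. x \<in> carrier ?R \<and> y \<triangleright>\<^bsub>?R\<^esub> x = z"
    proof (rule ex1I[of _ "r `` {ldiv Q a b}"])
      show "r `` {ldiv Q a b} \<in> carrier ?R \<and> y \<triangleright>\<^bsub>?R\<^esub> r `` {ldiv Q a b} = z"
        using a b by (simp add: cls ldiv_closed quotientI)
    next
      fix x assume x: "x \<in> carrier ?R \<and> y \<triangleright>\<^bsub>?R\<^esub> x = z"
      then obtain c where c: "c \<in> carrier Q" "x = r `` {c}" by (auto elim!: quotientE)
      \<comment> \<open>Cancellation modulo \<open>r\<close>: dividing both entries of this pair by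
        \<open>a\<close> on the left gives \<open>c\<close> and \<open>ldiv Q a b\<close>, which are
        therefore related.\<close>
      with x a b have "(a \<triangleright> c, b) \<in> r"
        using eq_equiv_class[OF _ e] by (simp add: cls)
      moreover have "(a, a) \<in> r" using e a by (auto simp: equiv_def refl_on_def)
      moreover have "ldiv Q a (a \<triangleright> c) = c" using a c by (intro ldiv_unique) auto
      ultimately have "(c, ldiv Q a b) \<in> r" using ld[of a a "a \<triangleright> c" b] by simp
      with c show "x = r `` {ldiv Q a b}" using equiv_class_eq[OF e] by simp
    qed
  next
    fix x y z assume "x \<in> carrier ?R" "y \<in> carrier ?R" "z \<in> carrier ?R"
    then show "x \<triangleright>\<^bsub>?R\<^esub> (y \<triangleright>\<^bsub>?R\<^esub> z) = (x \<triangleright>\<^bsub>?R\<^esub> y) \<triangleright>\<^bsub>?R\<^esub> (x \<triangleright>\<^bsub>?R\<^esub> z)"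
      by (auto elim!: quotientE simp: cls closed ldistrib[symmetric])
  qed (auto elim!: quotientE simp: cls closed idem quotientI)
qed

text \<open>On representatives, the two sides of the medial law are the classes of the two entries
  of a generating pair.\<close>

lemma (in quandle) medial_quandle_quotient_medial_cong:
  "medial_quandle (quotient_quandle Q (medial_cong Q))"
proof -
  let ?R = "quotient_quandle Q (medial_cong Q)"
  note cong = quandle_cong_medial_cong
  interpret R: quandle ?R by (rule quandle_quotient[OF cong])
  have e: "equiv (carrier Q) (medial_cong Q)" using cong by (simp add: quandle_cong_def)
  show ?thesis
  proof
    fix x y z w
    assume "x \<in> carrier ?R" "y \<in> carrier ?R" "z \<in> carrier ?R" "w \<in> carrier ?R"
    then obtain a b c d where
      "a \<in> carrier Q" "b \<in> carrier Q" "c \<in> carrier Q" "d \<in> carrier Q"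
      and "x = medial_cong Q `` {a}" "y = medial_cong Q `` {b}"
        "z = medial_cong Q `` {c}" "w = medial_cong Q `` {d}"
      by (auto elim!: quotientE)
    then show "(x \<triangleright>\<^bsub>?R\<^esub> y) \<triangleright>\<^bsub>?R\<^esub> (z \<triangleright>\<^bsub>?R\<^esub> w) = (x \<triangleright>\<^bsub>?R\<^esub> z) \<triangleright>\<^bsub>?R\<^esub> (y \<triangleright>\<^bsub>?R\<^esub> w)"
      using equiv_class_eq[OF e medial_congI[of a b c d]]
      by (simp add: quotient_qop_class[OF cong] closed)
  qed
qed

definition factor_hom ::
  "('a, 'm) magma_scheme \<Rightarrow> ('a \<times> 'a) set \<Rightarrow> ('a \<Rightarrow> 'b) \<Rightarrow> ('a set \<Rightarrow> 'b)" where
  "factor_hom S r h = (\<lambda>X\<in>carrier S // r. the_elem (h ` X))"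

lemma factor_hom_class:
  assumes "equiv (carrier S) r" "a \<in> carrier S" "\<And>a b. (a, b) \<in> r \<Longrightarrow> h a = h b"
  shows "factor_hom S r h (r `` {a}) = h a"
proof -
  \<comment> \<open>The class contains \<open>a\<close>, so the image is nonempty, and constancy of
    \<open>h\<close> on the class leaves no other value.\<close>
  have "h ` (r `` {a}) = {h a}"
    using equiv_class_self[OF assms(1,2)] by (auto dest: assms(3)[symmetric] intro: rev_image_eqI)
  with assms(2) show ?thesis by (simp add: factor_hom_def quotientI)
qed

lemma factor_hom_in_quandle_hom:
  assumes "quandle S" "quandle_cong S r" "h \<in> quandle_hom S T" "\<And>a b. (a, b) \<in> r \<Longrightarrow> h a = h b"
  shows "factor_hom S r h \<in> quandle_hom (quotient_quandle S r) T"
proof -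
  interpret S: quandle S by fact
  have e: "equiv (carrier S) r" using assms(2) by (simp add: quandle_cong_def)
  note cls = factor_hom_class[where h = h, OF e _ assms(4)]
  have "factor_hom S r h \<in> carrier S // r \<rightarrow>\<^sub>E carrier T"
  proof (rule PiE_I)
    fix X assume "X \<in> carrier S // r"
    then show "factor_hom S r h X \<in> carrier T"
      by (auto elim!: quotientE simp: cls quandle_hom_closed[OF assms(3)])
  qed (simp add: factor_hom_def)
  then show ?thesis
    by (auto simp: quandle_hom_def[of "quotient_quandle S r"] quotient_qop_class[OF assms(2)]
        S.closed cls quandle_hom_qop[OF assms(3)] elim!: quotientE)
qed

text \<open>This is \<open>g\<close> composed with the projection to the quotient; the projection
  respects \<triangleright> by \<open>quotient_qop_class\<close>.\<close>

lemma comp_class_in_quandle_hom: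
  assumes "quandle S" "quandle_cong S r" "g \<in> quandle_hom (quotient_quandle S r) T"
  shows "(\<lambda>a\<in>carrier S. g (r `` {a})) \<in> quandle_hom S T"
proof -
  interpret S: quandle S by fact
  show ?thesis
    using quandle_hom_closed[OF assms(3)] quandle_hom_qop[OF assms(3)]
    by (auto simp: quandle_hom_def[of S] S.closed quotientI quotient_qop_class[OF assms(2), symmetric])
qed

theorem theorem3p16:
  fixes S :: "('a, 'm) magma_scheme" and T :: "('b, 'n) magma_scheme"
  assumes "quandle S" and "medial_quandle T"
  shows "medial_quandle (quotient_quandle S (medial_cong S)) \<and>
    Hom_quandle S T \<cong>\<^sub>q Hom_quandle (quotient_quandle S (medial_cong S)) T"
proof
  interpret S: quandle S by fact
  let ?r = "medial_cong S"
  let ?Q = "quotient_quandle S ?r"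
  let ?H = "Hom_quandle S T" and ?H' = "Hom_quandle ?Q T"
  show "medial_quandle ?Q" by (rule S.medial_quandle_quotient_medial_cong)
  note cong = S.quandle_cong_medial_cong
  have e: "equiv (carrier S) ?r" using cong by (simp add: quandle_cong_def)
  \<comment> \<open>The two interpretations supply closure: a pointwise product of homomorphisms
    into \<open>T\<close> is again a homomorphism, because \<open>T\<close> is medial.\<close>
  interpret H: medial_quandle ?H by (rule medial_quandle_Hom[OF assms])
  interpret H': medial_quandle ?H'
    by (rule medial_quandle_Hom[OF S.quandle_quotient[OF cong] assms(2)])
  \<comment> \<open>\<open>F\<close> is itself an element of a \<open>quandle_hom\<close> set, hence
    the restriction to homomorphisms.\<close>
  define F where "F = (\<lambda>h\<in>quandle_hom S T. factor_hom S ?r h)"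
  let ?G = "\<lambda>g. \<lambda>a\<in>carrier S. g (?r `` {a})"
  have F: "F h \<in> quandle_hom ?Q T" if "h \<in> quandle_hom S T" for h
    using factor_hom_in_quandle_hom[OF assms(1) cong that medial_cong_subset_kernel[OF assms that]] that
    by (simp add: F_def)
  have F_class: "F h (?r `` {a}) = h a" if "h \<in> quandle_hom S T" "a \<in> carrier S" for h a
    using factor_hom_class[of S ?r a h, OF e that(2) medial_cong_subset_kernel[OF assms that(1)]] that(1)
    by (simp add: F_def)
  note G = comp_class_in_quandle_hom[OF assms(1) cong]
  have "F (h \<triangleright>\<^bsub>?H\<^esub> k) = F h \<triangleright>\<^bsub>?H'\<^esub> F k"
    if h: "h \<in> quandle_hom S T" and k: "k \<in> quandle_hom S T" for h k
  \<comment> \<open>Both sides are homomorphisms on the quotient, so they need only be compared on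
    the class of each \<open>a\<close>, where each takes the value of \<open>h a\<close>
    \<triangleright> \<open>k a\<close> in \<open>T\<close>.\<close>
  proof (rule quandle_hom_ext)
    have hk: "h \<triangleright>\<^bsub>?H\<^esub> k \<in> quandle_hom S T" using H.closed[of h k] h k by simp
    then show "F (h \<triangleright>\<^bsub>?H\<^esub> k) \<in> quandle_hom ?Q T" by (rule F)
    show "F h \<triangleright>\<^bsub>?H'\<^esub> F k \<in> quandle_hom ?Q T"
      using H'.closed[of "F h" "F k"] F[OF h] F[OF k] by simp
    fix X assume "X \<in> carrier ?Q"
    then obtain a where a: "a \<in> carrier S" "X = ?r `` {a}" by (auto elim!: quotientE)
    with F_class[OF hk a(1)] show "F (h \<triangleright>\<^bsub>?H\<^esub> k) X = (F h \<triangleright>\<^bsub>?H'\<^esub> F k) X"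
      by (simp add: F_class h k qop_Hom_quandle quotientI)
  qed
  then have "F \<in> quandle_hom ?H ?H'"
    using F by (auto simp: quandle_hom_def[of ?H] F_def)
  moreover have "bij_betw F (carrier ?H) (carrier ?H')"
  \<comment> \<open>The inverse is composition with the projection. Both round trips reduce to
    \<open>F_class\<close>: the second is checked on classes, which exhaust the carrier of the
    quotient.\<close>
  proof (rule bij_betw_byWitness[where f' = ?G])
    show "\<forall>h\<in>carrier ?H. ?G (F h) = h"
    proof
      fix h assume "h \<in> carrier ?H"
      then have h: "h \<in> quandle_hom S T" by simp
      show "?G (F h) = h"
        by (rule quandle_hom_ext[OF G[OF F[OF h]] h]) (simp add: F_class h)
    qed
    show "\<forall>g\<in>carrier ?H'. F (?G g) = g"
    proof
      fix g assume "g \<in> carrier ?H'"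
      then have g: "g \<in> quandle_hom ?Q T" by simp
      show "F (?G g) = g"
      proof (rule quandle_hom_ext[OF F[OF G[OF g]] g])
        fix X assume "X \<in> carrier ?Q"
        then obtain a where "a \<in> carrier S" "X = ?r `` {a}" by (auto elim!: quotientE)
        then show "F (?G g) X = g X" using F_class[OF G[OF g]] by simp
      qed
    qed
  qed (use F G in auto)
  ultimately show "?H \<cong>\<^sub>q ?H'" unfolding quandle_isomorphic_def by blast
qed

end
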